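(* Let $\mathcal{H}$ be a fixed finite set of connected graphs, let $D$ be the maximum diameter of the graphs in $\mathcal{H}$, suppose $\mathcal{H}$ contains $K_{1,s}$ for some $s>1$, and let $s>1$ be the least such integer. Fix an integer $t>2$, let $d=R(s,t-1)-1$ and $p=\log_{\frac{2d}{2d-1}}d$. Consider the following procedure, applied to an instance $(G,k)$ of $\mathcal{H}$-free Edge Deletion in which $G$ is $K_t$-free: (1) Let $V_R(G)$ be the set of vertices of $G$ of degree at least $d+1$. Delete from $G$ all vertices whose distance from $V_{\mathcal{H}}(G)\cup V_R(G)$ is more than $(2+\log_{\frac{2d}{2d-1}}k)D$; call the resulting graph $G'$. (2) If $|V(G')|>8d^{3D+1}\cdot k^{pD+1}$, output the instance $(K_{1,s},0)$; otherwise output $(G',k)$. Then the output instance has at most $8d^{1+3D}\cdot k^{1+pD}$ vertices, and it is a yes-instance of $\mathcal{H}$-free Edge Deletion if and only if $(G,k)$ is a yes-instance.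
   Context: All graphs are finite and simple. $R(s,t)$ is the Ramsey number: the least integer such that every graph on $R(s,t)$ vertices has an independent set of order $s$ or a complete subgraph of order $t$. For a set of graphs $\mathcal{H}$, a graph is $\mathcal{H}$-free if it has no induced subgraph isomorphic to a member of $\mathcal{H}$. The problem $\mathcal{H}$-free Edge Deletion: given a graph $G$ and a positive integer $k$ (the parameter), decide whether there exists $E'\subseteq E(G)$ with $|E'|\le k$ such that $G\setminus E'=(V(G),E(G)\setminus E')$ is $\mathcal{H}$-free. $V_{\mathcal{H}}(G)$ denotes the set of all vertices of $G$ that belong to some induced subgraph of $G$ isomorphic to a member of $\mathcal{H}$. The distance from a vertex $v$ to a set of vertices $V'$ is the minimum of the distances from $v$ to the vertices of $V'$. *)

theory Defs
  imports Complex_Main "HOL-Library.Extended_Real" "HOL-Library.Ramsey"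
begin

datatype 'a graph = Graph (verts: "'a set") (edges: "'a set set")

definition simple_graph :: "'a graph \<Rightarrow> bool" where
  "simple_graph G \<longleftrightarrow> finite (verts G) \<and> (\<forall>e\<in>edges G. e \<subseteq> verts G \<and> card e = 2)"

definition induced :: "'a graph \<Rightarrow> 'a set \<Rightarrow> 'a graph" where
  "induced G W = Graph W {e \<in> edges G. e \<subseteq> W}"

definition delete_vertices :: "'a graph \<Rightarrow> 'a set \<Rightarrow> 'a graph" where
  "delete_vertices G W = induced G (verts G - W)"

definition delete_edges :: "'a graph \<Rightarrow> 'a set set \<Rightarrow> 'a graph" where
  "delete_edges G F = Graph (verts G) (edges G - F)"

definition isomorphic :: "'a graph \<Rightarrow> 'b graph \<Rightarrow> bool" where
  "isomorphic G H \<longleftrightarrow>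
     (\<exists>f. bij_betw f (verts G) (verts H) \<and>
          (\<forall>u\<in>verts G. \<forall>v\<in>verts G. {u, v} \<in> edges G \<longleftrightarrow> {f u, f v} \<in> edges H))"

definition degree :: "'a graph \<Rightarrow> 'a \<Rightarrow> nat" where
  "degree G v = card {u \<in> verts G. {v, u} \<in> edges G}"

definition complete_graph :: "nat \<Rightarrow> nat graph" where
  "complete_graph n = Graph {..<n} {e. e \<subseteq> {..<n} \<and> card e = 2}"

text \<open>\<open>star s\<close> is \<open>K\<^sub>1\<^sub>,\<^sub>s\<close>, with centre 0.\<close>

definition star :: "nat \<Rightarrow> nat graph" where
  "star s = Graph {0..s} {{0, i} | i. i \<in> {1..s}}"

definition walk :: "'a graph \<Rightarrow> 'a list \<Rightarrow> bool" where
  "walk G p \<longleftrightarrow> p \<noteq> [] \<and> set p \<subseteq> verts G \<and> successively (\<lambda>u v. {u, v} \<in> edges G) p"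

text \<open>The distance is infinite between different components, and the distance to the empty set
  is infinite. Since a shortest walk is a path, walks and paths give the same distance.\<close>

definition distance :: "'a graph \<Rightarrow> 'a \<Rightarrow> 'a \<Rightarrow> enat" where
  "distance G u v = Inf {enat (length p - 1) | p. walk G p \<and> hd p = u \<and> last p = v}"

definition distance_to_set :: "'a graph \<Rightarrow> 'a \<Rightarrow> 'a set \<Rightarrow> enat" where
  "distance_to_set G v X = (INF x\<in>X. distance G v x)"

definition connected_graph :: "'a graph \<Rightarrow> bool" where
  "connected_graph G \<longleftrightarrow> verts G \<noteq> {} \<and>
     (\<forall>u\<in>verts G. \<forall>v\<in>verts G. \<exists>p. walk G p \<and> hd p = u \<and> last p = v)"

definition diameter :: "'a graph \<Rightarrow> enat" where
  "diameter G = (SUP u\<in>verts G. SUP v\<in>verts G. distance G u v)"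

text \<open>Every finite graph has a copy with vertices in \<open>nat\<close>, so these suffice here.\<close>

definition ramsey_number :: "nat \<Rightarrow> nat \<Rightarrow> nat" where
  "ramsey_number s t = (LEAST n. \<forall>G :: nat graph. simple_graph G \<and> card (verts G) = n \<longrightarrow>
     (\<exists>R\<subseteq>verts G. card R = s \<and> indep R (edges G) \<or> card R = t \<and> clique R (edges G)))"

definition induces_member :: "'b graph set \<Rightarrow> 'a graph \<Rightarrow> 'a set \<Rightarrow> bool" where
  "induces_member \<H> G W \<longleftrightarrow> W \<subseteq> verts G \<and> (\<exists>H\<in>\<H>. isomorphic (induced G W) H)"

definition free_of :: "'b graph set \<Rightarrow> 'a graph \<Rightarrow> bool" where
  "free_of \<H> G \<longleftrightarrow> \<not> (\<exists>W. induces_member \<H> G W)"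

definition V_H :: "'b graph set \<Rightarrow> 'a graph \<Rightarrow> 'a set" where
  "V_H \<H> G = \<Union>{W. induces_member \<H> G W}"

definition V_R :: "nat \<Rightarrow> 'a graph \<Rightarrow> 'a set" where
  "V_R d G = {v \<in> verts G. degree G v \<ge> d + 1}"

definition edge_deletion_yes :: "'b graph set \<Rightarrow> 'a graph \<times> nat \<Rightarrow> bool" where
  "edge_deletion_yes \<H> = (\<lambda>(G, k).
     \<exists>E'\<subseteq>edges G. card E' \<le> k \<and> free_of \<H> (delete_edges G E'))"

definition trim :: "'b graph set \<Rightarrow> nat \<Rightarrow> nat \<Rightarrow> 'a graph \<Rightarrow> nat \<Rightarrow> 'a graph" where
  "trim \<H> D d G k = delete_vertices G
     {v \<in> verts G. ereal_of_enat (distance_to_set G v (V_H \<H> G \<union> V_R d G))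
        > ereal ((2 + log (2 * real d / (2 * real d - 1)) (real k)) * real D)}"

text \<open>\<open>K\<close> is the copy of \<open>K\<^sub>1\<^sub>,\<^sub>s\<close>, on the vertex type of the input, that is output when the
  trimmed graph is too large.\<close>

definition kernelize ::
  "'b graph set \<Rightarrow> 'a graph \<Rightarrow> nat \<Rightarrow> nat \<Rightarrow> real \<Rightarrow> 'a graph \<times> nat \<Rightarrow> 'a graph \<times> nat" where
  "kernelize \<H> K D d p = (\<lambda>(G, k).
     let G' = trim \<H> D d G k in
     if real (card (verts G')) > 8 * real d ^ (3 * D + 1) * real k powr (p * real D + 1)
     then (K, 0) else (G', k))"

end

theory Submission
  imports Defs
begin

text \<open>By Ramsey's theorem a vertex of degree more than \<open>d\<close> in a \<open>K\<^sub>t\<close>-free graph is the centre of an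
  induced \<open>K\<^sub>1\<^sub>,\<^sub>s\<close>. Hence \<open>V_R d G \<subseteq> V_H \<H> G\<close>, and the graph has maximum degree at most \<open>d\<close> outside
  \<open>V_H \<H> G\<close>, and everywhere once a solution has been deleted.

  Sort the edges of an optimal solution of the trimmed graph into layers of width \<open>D\<close> around
  \<open>V_H \<H> G\<close>. Isolating one endpoint of each edge of a layer makes all later layers superfluous, at
  cost \<open>d\<close> per edge, so optimality forces the number of edges beyond layer \<open>r\<close> to decay geometrically
  in \<open>r\<close>. The whole solution thus lies within distance \<open>(1 + log k) D\<close> of \<open>V_H \<H> G\<close>. A copy of a
  member of \<open>\<H>\<close> that survives in \<open>G\<close> contains a deleted edge or lies in \<open>V_H \<H> G\<close>; either way it
  lies inside the trimmed graph, which is a contradiction.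

  For the size, every vertex of \<open>V_H \<H> G\<close> is within distance \<open>D\<close> of an endpoint of a deleted edge,
  so after the deletion the trimmed graph is covered by at most \<open>2 k\<close> balls of radius
  \<open>(3 + log k) D\<close> in a graph of maximum degree \<open>d\<close>.\<close>

section \<open>Balls around vertex sets, walks and distances\<close>

text \<open>The closed ball of radius \<open>n\<close> around \<open>X\<close>, by recursion on the
  radius, so that facts about distances become inductions on natural numbers instead of arguments
  about infima of \<open>enat\<close>.\<close>

primrec nbhd :: "'a graph \<Rightarrow> nat \<Rightarrow> 'a set \<Rightarrow> 'a set" where
  "nbhd G 0 X = X"
| "nbhd G (Suc n) X = nbhd G n X \<union> {v \<in> verts G. \<exists>u\<in>nbhd G n X. {u, v} \<in> edges G}"

lemma nbhd_mono:
  assumes "verts G \<subseteq> verts G'" "edges G \<subseteq> edges G'" "X \<subseteq> Y" "m \<le> n"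
  shows "nbhd G m X \<subseteq> nbhd G' n Y"
proof -
  have "nbhd G m X \<subseteq> nbhd G' m Y"
    using assms(1-3) by (induction m) (simp, fastforce)
  also have "nbhd G' m Y \<subseteq> nbhd G' n Y"
    using \<open>m \<le> n\<close> by (induction rule: dec_induct) auto
  finally show ?thesis .
qed

lemma nbhd_add: "nbhd G (m + n) X = nbhd G m (nbhd G n X)"
  by (induction m) auto

lemma nbhd_subset_verts: "X \<subseteq> verts G \<Longrightarrow> nbhd G n X \<subseteq> verts G"
  by (induction n) auto

lemma nbhd_trans:
  assumes "x \<in> nbhd G m Y" "Y \<subseteq> nbhd G n X"
  shows "x \<in> nbhd G (m + n) X"
  using assms nbhd_mono[of G G Y "nbhd G n X" m m] by (auto simp: nbhd_add)

lemma walk_in_nbhd: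
  assumes "walk G p" "last p \<in> X"
  shows "hd p \<in> nbhd G (length p - 1) X"
  using assms
proof (induction p)
  case (Cons u p)
  show ?case
  proof (cases p)
    case Nil
    with Cons.prems show ?thesis by simp
  next
    case (Cons v q)
    with Cons.prems have "walk G p" "{u, v} \<in> edges G" "u \<in> verts G" "last p \<in> X"
      by (auto simp: walk_def)
    with Cons.IH Cons show ?thesis by (auto simp: insert_commute)
  qed
qed (simp add: walk_def)

lemma nbhd_walk:
  assumes "v \<in> nbhd G n X" "X \<subseteq> verts G"
  shows "\<exists>p. walk G p \<and> hd p = v \<and> last p \<in> X \<and> length p - 1 \<le> n"
  using assms(1)
proof (induction n arbitrary: v)
  case 0
  with assms(2) show ?case by (intro exI[of _ "[v]"]) (auto simp: walk_def)
next
  case (Suc n)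
  show ?case
  proof (cases "v \<in> nbhd G n X")
    case True
    with Suc.IH show ?thesis by fastforce
  next
    case False
    with Suc.prems obtain u where u: "v \<in> verts G" "u \<in> nbhd G n X" "{u, v} \<in> edges G"
      by auto
    with Suc.IH obtain p where p: "walk G p" "hd p = u" "last p \<in> X" "length p - 1 \<le> n"
      by blast
    then show ?thesis using u
      by (intro exI[of _ "v # p"])
        (auto simp: walk_def successively_Cons insert_commute Suc_le_eq)
  qed
qed

text \<open>The infimum of a nonempty set of \<open>enat\<close> is its least element, hence
  attained; that of the empty set is infinite and never below \<open>enat n\<close>.\<close>

lemma Inf_enat_le_iff: "Inf A \<le> enat n \<longleftrightarrow> (\<exists>x\<in>A. x \<le> enat n)" for A :: "enat set"
proof
  assume "Inf A \<le> enat n"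
  moreover from this have "A \<noteq> {}" by (auto simp: Inf_enat_def)
  moreover from this have "Inf A \<in> A" by (auto simp: Inf_enat_def intro: LeastI)
  ultimately show "\<exists>x\<in>A. x \<le> enat n" by blast
qed (meson Inf_lower order_trans)

lemma distance_le_iff:
  "distance G u v \<le> enat n \<longleftrightarrow> (\<exists>p. walk G p \<and> hd p = u \<and> last p = v \<and> length p - 1 \<le> n)"
  unfolding distance_def Inf_enat_le_iff by auto

lemma distance_to_set_le_iff:
  assumes "X \<subseteq> verts G"
  shows "distance_to_set G v X \<le> enat n \<longleftrightarrow> v \<in> nbhd G n X"
proof
  assume "distance_to_set G v X \<le> enat n"
  then obtain x p where "x \<in> X" "walk G p" "hd p = v" "last p = x" "length p - 1 \<le> n"
    unfolding distance_to_set_def Inf_enat_le_iff by (auto simp: distance_le_iff)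
  then show "v \<in> nbhd G n X"
    using walk_in_nbhd[of G p X] nbhd_mono[of G G X X "length p - 1" n] by auto
next
  assume "v \<in> nbhd G n X"
  from nbhd_walk[OF this assms] show "distance_to_set G v X \<le> enat n"
    unfolding distance_to_set_def Inf_enat_le_iff by (auto simp: distance_le_iff)
qed

text \<open>Distances are integers or infinite, so the real threshold of \<open>trim\<close> can be
  rounded down to a natural radius.\<close>

lemma ereal_of_enat_gt_iff:
  assumes "T \<ge> 0"
  shows "ereal_of_enat x > ereal T \<longleftrightarrow> \<not> x \<le> enat (nat \<lfloor>T\<rfloor>)"
proof (cases x)
  case (enat n)
  have "n \<le> nat \<lfloor>T\<rfloor> \<longleftrightarrow> real n \<le> T"
    using assms by linarith
  with enat show ?thesis by (simp add: not_le[symmetric])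
qed auto

section \<open>Simple graphs, isomorphism and induced copies of members\<close>

lemma simple_graph_induced: "simple_graph G \<Longrightarrow> W \<subseteq> verts G \<Longrightarrow> simple_graph (induced G W)"
  by (auto simp: simple_graph_def induced_def intro: finite_subset)

lemma simple_graph_delete_edges: "simple_graph G \<Longrightarrow> simple_graph (delete_edges G F)"
  by (auto simp: simple_graph_def delete_edges_def)

lemma finite_edges: "simple_graph G \<Longrightarrow> finite (edges G)"
  by (rule finite_subset[of _ "Pow (verts G)"]) (auto simp: simple_graph_def)

lemma simple_graph_no_loop: "simple_graph G \<Longrightarrow> {v} \<notin> edges G"
  by (force simp: simple_graph_def)

lemma simple_graph_edge:
  assumes "simple_graph G" "e \<in> edges G"
  shows "\<exists>u v. e = {u, v} \<and> u \<noteq> v \<and> u \<in> verts G \<and> v \<in> verts G"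
proof -
  from assms have "card e = 2" "e \<subseteq> verts G" by (auto simp: simple_graph_def)
  then show ?thesis by (auto simp: card_2_iff)
qed

lemma isomorphic_sym:
  assumes "isomorphic G H"
  shows "isomorphic H G"
proof -
  from assms obtain f where f: "bij_betw f (verts G) (verts H)"
    "\<And>u v. u \<in> verts G \<Longrightarrow> v \<in> verts G \<Longrightarrow> {u, v} \<in> edges G \<longleftrightarrow> {f u, f v} \<in> edges H"
    by (auto simp: isomorphic_def)
  let ?g = "inv_into (verts G) f"
  have g: "bij_betw ?g (verts H) (verts G)" by (rule bij_betw_inv_into[OF f(1)])
  have "{u, v} \<in> edges H \<longleftrightarrow> {?g u, ?g v} \<in> edges G" if "u \<in> verts H" "v \<in> verts H" for u v
    using f(2)[of "?g u" "?g v"] that bij_betwE[OF g] bij_betw_inv_into_right[OF f(1)] by simp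
  with g show ?thesis by (auto simp: isomorphic_def)
qed

lemma isomorphic_trans:
  assumes "isomorphic G H" "isomorphic H K"
  shows "isomorphic G K"
proof -
  from assms(1) obtain f where f: "bij_betw f (verts G) (verts H)"
    "\<And>u v. u \<in> verts G \<Longrightarrow> v \<in> verts G \<Longrightarrow> {u, v} \<in> edges G \<longleftrightarrow> {f u, f v} \<in> edges H"
    by (auto simp: isomorphic_def)
  from assms(2) obtain g where g: "bij_betw g (verts H) (verts K)"
    "\<And>u v. u \<in> verts H \<Longrightarrow> v \<in> verts H \<Longrightarrow> {u, v} \<in> edges H \<longleftrightarrow> {g u, g v} \<in> edges K"
    by (auto simp: isomorphic_def)
  show ?thesis unfolding isomorphic_def
    using bij_betw_trans[OF f(1) g(1)] f(2) g(2) bij_betwE[OF f(1)]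
    by (intro exI[of _ "g \<circ> f"]) auto
qed

text \<open>Used to move a copy between graphs that agree inside \<open>W\<close>: the induced graph
  on \<open>W\<close> is then literally the same.\<close>

lemma induces_member_cong:
  assumes "induces_member \<H> G W" "W \<subseteq> verts G'"
    and "\<And>e. e \<subseteq> W \<Longrightarrow> e \<in> edges G \<longleftrightarrow> e \<in> edges G'"
  shows "induces_member \<H> G' W"
proof -
  from assms(3) have "induced G W = induced G' W" by (auto simp: induced_def)
  with assms(1,2) show ?thesis by (simp add: induces_member_def)
qed

text \<open>The isomorphism carries a short walk of \<open>H\<close> to a walk inside
  \<open>induced G W\<close>. The ball is taken there and not in \<open>G\<close>, so that a copy
  with an isolated vertex can be shown to be that single vertex.\<close>

lemma induces_member_walk:
  assumes "induces_member \<H> G W" "\<And>H. H \<in> \<H> \<Longrightarrow> diameter H \<le> enat D" "u \<in> W" "v \<in> W"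
  shows "v \<in> nbhd (induced G W) D {u}"
proof -
  from assms(1) obtain H where H: "H \<in> \<H>" "isomorphic H (induced G W)"
    by (auto simp: induces_member_def intro: isomorphic_sym)
  then obtain g where g: "bij_betw g (verts H) W"
    "\<And>u v. u \<in> verts H \<Longrightarrow> v \<in> verts H \<Longrightarrow> {u, v} \<in> edges H \<longleftrightarrow> {g u, g v} \<in> edges (induced G W)"
    by (auto simp: isomorphic_def induced_def)
  from g(1) assms(3,4) obtain a b where ab: "a \<in> verts H" "b \<in> verts H" "u = g a" "v = g b"
    by (auto simp: bij_betw_def)
  \<comment> \<open>From \<open>b\<close> to \<open>a\<close>, since \<open>walk_in_nbhd\<close>
    places the head of a walk in a ball around its last vertex.\<close>
  have "distance H b a \<le> diameter H"
    unfolding diameter_def using ab by (meson SUP_upper order_trans)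
  with assms(2)[OF H(1)] have "distance H b a \<le> enat D" by (meson order_trans)
  then obtain q where q: "walk H q" "hd q = b" "last q = a" "length q - 1 \<le> D"
    unfolding distance_le_iff by blast
  have "successively (\<lambda>u v. {g u, g v} \<in> edges (induced G W)) q"
    by (rule successively_mono[of "\<lambda>u v. {u, v} \<in> edges H"])
      (use q(1) g(2) in \<open>auto simp: walk_def subset_iff\<close>)
  then have "walk (induced G W) (map g q)"
    using q(1) g(1) by (auto simp: walk_def successively_map bij_betw_def induced_def)
  from walk_in_nbhd[OF this, of "{u}"] q ab
  have "v \<in> nbhd (induced G W) (length q - 1) {u}"
    by (cases "q = []") (auto simp: walk_def last_map hd_map)
  with q(4) nbhd_mono[of "induced G W" "induced G W" "{u}" "{u}" "length q - 1" D]
  show ?thesis by auto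
qed

lemma induces_member_nbhd:
  assumes "induces_member \<H> G W" "\<And>H. H \<in> \<H> \<Longrightarrow> diameter H \<le> enat D" "u \<in> W"
  shows "W \<subseteq> nbhd G D {u}"
proof
  fix v assume "v \<in> W"
  from induces_member_walk[OF assms this] have "v \<in> nbhd (induced G W) D {u}" .
  moreover have "W \<subseteq> verts G" using assms(1) by (simp add: induces_member_def)
  ultimately show "v \<in> nbhd G D {u}"
    using nbhd_mono[of "induced G W" G "{u}" "{u}" D D] by (auto simp: induced_def)
qed

section \<open>Cliques, Ramsey numbers and vertices of high degree\<close>

text \<open>The subgraph form of containing \<open>K_t\<close>. Unlike the induced form it is
  monotone in the edges, so its negation passes to graphs with edges deleted.\<close>

definition has_clique :: "'a graph \<Rightarrow> nat \<Rightarrow> bool" where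
  "has_clique G t \<longleftrightarrow> (\<exists>R\<subseteq>verts G. card R = t \<and> clique R (edges G))"

lemma has_clique_mono:
  assumes "has_clique G t" "verts G \<subseteq> verts G'" "edges G \<subseteq> edges G'"
  shows "has_clique G' t"
proof -
  from assms(1) obtain R where "R \<subseteq> verts G" "card R = t" "clique R (edges G)"
    by (auto simp: has_clique_def)
  moreover from this(3) have "clique R (edges G')"
    using assms(3) by (auto simp: clique_def)
  ultimately show ?thesis using assms(2) by (auto simp: has_clique_def)
qed

lemma clique_free_of:
  assumes "simple_graph G" "free_of {complete_graph t} G"
  shows "\<not> has_clique G t"
proof
  assume "has_clique G t"
  then obtain R where R: "R \<subseteq> verts G" "card R = t" "clique R (edges G)"
    by (auto simp: has_clique_def)
  moreover have "finite R" using R(1) assms(1) by (auto simp: simple_graph_def intro: finite_subset)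
  ultimately obtain f where f: "bij_betw f R {..<t}"
    using ex_bij_betw_finite_nat by (metis atLeast0LessThan)
  have "{u, v} \<in> edges (induced G R) \<longleftrightarrow> {f u, f v} \<in> edges (complete_graph t)"
    if uv: "u \<in> R" "v \<in> R" for u v
  proof (cases "u = v")
    case True
    with simple_graph_no_loop[OF assms(1)] show ?thesis
      by (simp add: induced_def complete_graph_def)
  next
    case False
    moreover from False f uv have "f u \<noteq> f v" by (auto simp: bij_betw_def inj_on_def)
    ultimately show ?thesis
      using uv R(3) bij_betwE[OF f] by (auto simp: induced_def complete_graph_def clique_def)
  qed
  with f have "isomorphic (induced G R) (complete_graph t)"
    by (auto simp: isomorphic_def induced_def complete_graph_def)
  with R(1) assms(2) show False by (auto simp: free_of_def induces_member_def)
qed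

text \<open>The predicate under \<open>LEAST\<close> in \<open>ramsey_number\<close>, named so that
  \<open>LeastI\<close> applies.\<close>

definition ramsey_property :: "nat \<Rightarrow> nat \<Rightarrow> nat \<Rightarrow> bool" where
  "ramsey_property s t n \<longleftrightarrow> (\<forall>G :: nat graph. simple_graph G \<and> card (verts G) = n \<longrightarrow>
     (\<exists>R\<subseteq>verts G. card R = s \<and> indep R (edges G) \<or> card R = t \<and> clique R (edges G)))"

lemma ramsey_property_ramsey_number: "ramsey_property s t (ramsey_number s t)"
proof -
  obtain r where r: "\<And>(V :: nat set) E. finite V \<Longrightarrow> card V \<ge> r \<Longrightarrow>
      \<exists>R\<subseteq>V. card R = t \<and> clique R E \<or> card R = s \<and> indep R E"
    using ramsey2[of t s] by blast
  then have "ramsey_property s t r"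
    unfolding ramsey_property_def simple_graph_def by (metis order_refl)
  then show ?thesis
    unfolding ramsey_number_def ramsey_property_def[symmetric] by (rule LeastI)
qed

text \<open>An edgeless graph has no clique with more than one vertex, so it must supply an
  independent set of size \<open>s\<close>. This yields \<open>d \<ge> 1\<close> later.\<close>

lemma ramsey_number_ge:
  assumes "t > 1"
  shows "ramsey_number s t \<ge> s"
proof (rule ccontr)
  let ?n = "ramsey_number s t"
  let ?G = "Graph {..<?n} {} :: nat graph"
  assume "\<not> ?n \<ge> s"
  moreover have "simple_graph ?G" "card (verts ?G) = ?n" by (auto simp: simple_graph_def)
  with ramsey_property_ramsey_number[of s t] obtain R where R: "R \<subseteq> {..<?n}"
    "card R = s \<or> card R = t \<and> clique R {}"
    unfolding ramsey_property_def by force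
  have "card R \<le> ?n" using card_mono[OF _ R(1)] by simp
  ultimately have "card R = t" "clique R {}" using R(2) by auto
  moreover have "finite R" using R(1) finite_subset by blast
  ultimately show False
    using assms card_le_Suc0_iff_eq[of R] by (auto simp: clique_def)
qed

text \<open>The definition only covers graphs on \<open>nat\<close> with exactly
  \<open>ramsey_number s t\<close> vertices; the general case follows by shrinking \<open>V\<close>
  to that size and pulling \<open>E\<close> back along a bijection.\<close>

lemma ramsey_number_subset:
  fixes V :: "'a set"
  assumes "finite V" "card V \<ge> ramsey_number s t"
  shows "\<exists>R\<subseteq>V. card R = s \<and> indep R E \<or> card R = t \<and> clique R E"
proof -
  let ?n = "ramsey_number s t"
  obtain V' where V': "V' \<subseteq> V" "card V' = ?n" "finite V'"
    using obtain_subset_with_card_n[OF assms(2)] by metis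
  then obtain h where h: "bij_betw h {..<?n} V'"
    using ex_bij_betw_nat_finite[of V'] by (auto simp: atLeast0LessThan)
  \<comment> \<open>Only pairs of distinct vertices are kept, which makes the graph simple for
    arbitrary \<open>E\<close>.\<close>
  define F where "F = {{i, j} | i j. i < ?n \<and> j < ?n \<and> i \<noteq> j \<and> {h i, h j} \<in> E}"
  let ?G = "Graph {..<?n} F"
  have "simple_graph ?G \<and> card (verts ?G) = ?n" by (auto simp: simple_graph_def F_def)
  with ramsey_property_ramsey_number[of s t, unfolded ramsey_property_def, THEN spec, of ?G]
  obtain R where R: "R \<subseteq> verts ?G"
    "card R = s \<and> indep R F \<or> card R = t \<and> clique R F"
    by auto
  from R(1) have R1: "R \<subseteq> {..<?n}" by simp
  have inj: "inj_on h R" using h R1 by (auto simp: bij_betw_def intro: inj_on_subset)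
  have E: "{i, j} \<in> F \<longleftrightarrow> {h i, h j} \<in> E" if "i \<in> R" "j \<in> R" "i \<noteq> j" for i j
    using that R1 by (auto simp: F_def doubleton_eq_iff insert_commute)
  have cardR: "card (h ` R) = card R" using inj by (rule card_image)
  have indepR: "indep (h ` R) E" if "indep R F"
    unfolding indep_def
  proof (intro ballI impI)
    fix v w assume "v \<in> h ` R" "w \<in> h ` R" "v \<noteq> w"
    then obtain i j where "i \<in> R" "j \<in> R" "i \<noteq> j" "v = h i" "w = h j" by blast
    with that E[of i j] show "{v, w} \<notin> E" by (simp add: indep_def)
  qed
  have cliqueR: "clique (h ` R) E" if "clique R F"
    unfolding clique_def
  proof (intro ballI impI)
    fix v w assume "v \<in> h ` R" "w \<in> h ` R" "v \<noteq> w"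
    then obtain i j where "i \<in> R" "j \<in> R" "i \<noteq> j" "v = h i" "w = h j" by blast
    with that E[of i j] show "{v, w} \<in> E" by (simp add: clique_def)
  qed
  have subR: "h ` R \<subseteq> V" using bij_betw_imp_surj_on[OF h] R1 V'(1) by blast
  from R(2) have "card (h ` R) = s \<and> indep (h ` R) E \<or> card (h ` R) = t \<and> clique (h ` R) E"
    using indepR cliqueR by (simp only: cardR) blast
  with subR show ?thesis by blast
qed

text \<open>Ramsey's theorem is applied to the neighbours of \<open>v\<close>. A clique of size
  \<open>t\<close> among them would grow by \<open>v\<close>, so there is an independent set of size
  \<open>s\<close>, and \<open>v\<close> is the centre of the star.\<close>

lemma high_degree_star:
  assumes G: "simple_graph G" "\<not> has_clique G (Suc t)"
    and v: "v \<in> verts G" "degree G v \<ge> ramsey_number s t"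
  shows "\<exists>W\<subseteq>verts G. v \<in> W \<and> isomorphic (induced G W) (star s)"
proof -
  let ?N = "{u \<in> verts G. {v, u} \<in> edges G}"
  have fin: "finite ?N" using G(1) by (simp add: simple_graph_def)
  then obtain R where R: "R \<subseteq> ?N"
    "card R = s \<and> indep R (edges G) \<or> card R = t \<and> clique R (edges G)"
    using ramsey_number_subset[of ?N s t "edges G"] v(2) by (auto simp: degree_def)
  have finR: "finite R" using R(1) fin finite_subset by blast
  have vR: "v \<notin> R" using R(1) simple_graph_no_loop[OF G(1), of v] by auto
  have sub: "insert v R \<subseteq> verts G" using R(1) v(1) by auto
  have "\<not> (card R = t \<and> clique R (edges G))"
  proof
    assume *: "card R = t \<and> clique R (edges G)"
    then have "clique (insert v R) (edges G)"
      using R(1) by (auto simp: clique_def insert_commute)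
    moreover have "card (insert v R) = Suc t" using finR vR * by simp
    ultimately show False using sub G(2) by (auto simp: has_clique_def)
  qed
  with R(2) have Rs: "card R = s" "indep R (edges G)" by auto
  obtain f0 where f0: "bij_betw f0 R {1..s}"
    using finR Rs(1) by (metis ex_bij_betw_nat_finite_1 bij_betw_inv)
  define f where "f = f0(v := 0)"
  have fR: "f u = f0 u" "f u \<in> {1..s}" if "u \<in> R" for u
    using that vR bij_betwE[OF f0] by (auto simp: f_def)
  have fv: "f v = 0" by (simp add: f_def)
  have "bij_betw f R {1..s}" using f0 fR by (simp cong: bij_betw_cong)
  then have bij: "bij_betw f (insert v R) {0..s}"
    using fv vR by (auto simp: bij_betw_def image_iff atLeastAtMost_insertL[symmetric])
  have "{x, y} \<in> edges (induced G (insert v R)) \<longleftrightarrow> {f x, f y} \<in> edges (star s)"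
    if xy: "x \<in> insert v R" "y \<in> insert v R" for x y
  proof -
    consider "x = v" "y = v" | "x = v" "y \<in> R" | "x \<in> R" "y = v" | "x \<in> R" "y \<in> R"
      using xy by blast
    then show ?thesis
    proof cases
      case 1
      with simple_graph_no_loop[OF G(1)] show ?thesis
        by (auto simp: fv induced_def star_def doubleton_eq_iff)
    next
      case 2
      with R(1) fR(2)[of y] show ?thesis
        by (auto simp: fv induced_def star_def doubleton_eq_iff)
    next
      case 3
      with R(1) fR(2)[of x] show ?thesis
        by (auto simp: fv induced_def star_def doubleton_eq_iff insert_commute)
    next
      case 4
      then have "{x, y} \<notin> edges G"
        using Rs(2) simple_graph_no_loop[OF G(1)] by (cases "x = y") (auto simp: indep_def)
      with 4 fR(2)[of x] fR(2)[of y] show ?thesis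
        by (auto simp: induced_def star_def doubleton_eq_iff)
    qed
  qed
  with bij have "isomorphic (induced G (insert v R)) (star s)"
    by (auto simp: isomorphic_def induced_def star_def)
  with sub show ?thesis by blast
qed

lemma high_degree_in_V_H:
  assumes "simple_graph G" "\<not> has_clique G (Suc t)" "H \<in> \<H>" "isomorphic H (star s)"
    and "v \<in> verts G" "degree G v \<ge> ramsey_number s t"
  shows "v \<in> V_H \<H> G"
proof -
  from high_degree_star[OF assms(1,2,5,6)]
  obtain W where W: "W \<subseteq> verts G" "v \<in> W" "isomorphic (induced G W) (star s)" by blast
  from isomorphic_trans[OF W(3) isomorphic_sym[OF assms(4)]] W(1) assms(3)
  have "induces_member \<H> G W" by (auto simp: induces_member_def)
  with W(2) show ?thesis by (auto simp: V_H_def)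
qed

lemma V_H_subset_verts: "V_H \<H> G \<subseteq> verts G"
  by (auto simp: V_H_def induces_member_def)

section \<open>Stability and growth of balls\<close>

lemma nbhd_isolated:
  assumes "\<And>e. e \<in> edges G \<Longrightarrow> v \<notin> e"
  shows "nbhd G n {v} = {v}"
  using assms by (induction n) auto

text \<open>A shortest walk to \<open>X\<close> never leaves the ball, so restricting to the ball
  preserves these distances. The radius \<open>m\<close> is separate so that the induction keeps the
  graph fixed.\<close>

lemma nbhd_induced:
  assumes "m \<le> n"
  shows "nbhd G m X \<subseteq> nbhd (induced G (nbhd G n X)) m X"
  using assms
proof (induction m)
  case (Suc m)
  have *: "nbhd G (Suc m) X \<subseteq> nbhd G n X" "nbhd G m X \<subseteq> nbhd G n X"
    by (rule nbhd_mono; use Suc.prems in simp)+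
  show ?case
  proof
    fix v assume v: "v \<in> nbhd G (Suc m) X"
    show "v \<in> nbhd (induced G (nbhd G n X)) (Suc m) X"
    proof (cases "v \<in> nbhd G m X")
      case True
      with Suc show ?thesis by auto
    next
      case False
      with v obtain u where "u \<in> nbhd G m X" "{u, v} \<in> edges G" by auto
      with Suc v * show ?thesis by (auto simp: induced_def simp del: nbhd.simps(2)) auto
    qed
  qed
qed simp

text \<open>Both ends of a deleted edge lie in the centre \<open>\<Union>F\<close>, so no shortest
  walk to the centre uses a deleted edge.\<close>

lemma nbhd_delete_edges: "nbhd G n (\<Union>F) \<subseteq> nbhd (delete_edges G F) n (\<Union>F)"
proof (induction n)
  case (Suc n)
  show ?case
  proof
    fix v assume v: "v \<in> nbhd G (Suc n) (\<Union>F)"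
    show "v \<in> nbhd (delete_edges G F) (Suc n) (\<Union>F)"
    proof (cases "v \<in> nbhd G n (\<Union>F)")
      case True
      with Suc show ?thesis by auto
    next
      case False
      with v obtain u where u: "v \<in> verts G" "u \<in> nbhd G n (\<Union>F)" "{u, v} \<in> edges G" by auto
      show ?thesis
      proof (cases "{u, v} \<in> F")
        case True
        then have "v \<in> \<Union>F" by blast
        then show ?thesis
          using nbhd_mono[of "delete_edges G F" "delete_edges G F" "\<Union>F" "\<Union>F" 0 "Suc n"] by auto
      next
        case False
        with u Suc show ?thesis by (auto simp: delete_edges_def)
      qed
    qed
  qed
qed simp

lemma card_UN_bounded:
  assumes "finite I" "\<And>i. i \<in> I \<Longrightarrow> card (A i) \<le> c"
  shows "card (\<Union>i\<in>I. A i) \<le> c * card I"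
proof -
  have "card (\<Union>i\<in>I. A i) \<le> (\<Sum>i\<in>I. card (A i))" by (rule card_UN_le[OF assms(1)])
  also have "\<dots> \<le> card I * c" using sum_bounded_above[of I "\<lambda>i. card (A i)" c] assms(2) by simp
  finally show ?thesis by (simp add: mult.commute)
qed

text \<open>A vertex of the outermost layer has a neighbour in the previous ball, so it contributes
  at most \<open>d - 1\<close> new vertices. This saves the factor \<open>d + 1\<close> in favour of
  \<open>d\<close>.\<close>

lemma card_nbhd_Suc_Suc:
  assumes G: "simple_graph G" "S \<subseteq> verts G" and deg: "\<And>v. v \<in> verts G \<Longrightarrow> degree G v \<le> d"
    and "d \<ge> 1"
  shows "card (nbhd G (Suc (Suc n)) S) \<le> d * card (nbhd G (Suc n) S)"
proof -
  let ?B = "\<lambda>n. nbhd G n S"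
  let ?N = "\<lambda>v. {u \<in> verts G. {v, u} \<in> edges G}"
  have V: "finite (verts G)" using G(1) by (simp add: simple_graph_def)
  have fin: "finite (?B n)" for n
    using nbhd_subset_verts[OF G(2)] V finite_subset by metis
  let ?L = "?B (Suc n) - ?B n"
  have step: "card (?N u - ?B n) \<le> d - 1" if u: "u \<in> ?L" for u
  proof -
    from u obtain w where w: "w \<in> ?B n" "{w, u} \<in> edges G" by auto
    then have "w \<in> ?N u" using nbhd_subset_verts[OF G(2)] by (auto simp: insert_commute)
    then have "card (?N u - ?B n) \<le> card (?N u - {w})"
      using w(1) V by (intro card_mono) auto
    also have "\<dots> = degree G u - 1"
      using \<open>w \<in> ?N u\<close> V by (simp add: degree_def)
    also have "\<dots> \<le> d - 1"
      using deg[of u] u nbhd_subset_verts[OF G(2), of "Suc n"] by (auto intro!: diff_le_mono)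
    finally show ?thesis .
  qed
  have "?B (Suc (Suc n)) \<subseteq> ?B (Suc n) \<union> (\<Union>u\<in>?L. ?N u - ?B n)" by auto
  then have "card (?B (Suc (Suc n))) \<le> card (?B (Suc n) \<union> (\<Union>u\<in>?L. ?N u - ?B n))"
    using fin V by (intro card_mono finite_UnI finite_UN_I) (auto simp del: nbhd.simps(2))
  also have "\<dots> \<le> card (?B (Suc n)) + card (\<Union>u\<in>?L. ?N u - ?B n)" by (rule card_Un_le)
  also have "card (\<Union>u\<in>?L. ?N u - ?B n) \<le> (d - 1) * card ?L"
    using fin step by (intro card_UN_bounded) (auto simp del: nbhd.simps(2))
  also have "(d - 1) * card ?L \<le> (d - 1) * card (?B (Suc n))"
    using fin by (intro mult_left_mono card_mono) (auto simp del: nbhd.simps(2))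
  also have "card (?B (Suc n)) + (d - 1) * card (?B (Suc n)) = d * card (?B (Suc n))"
    using \<open>d \<ge> 1\<close> by (cases d) auto
  finally show ?thesis by simp
qed

text \<open>Only the first step can grow by the factor \<open>d + 1 \<le> 2 * d\<close>; each later
  step costs a factor \<open>d\<close>.\<close>

lemma card_nbhd_le:
  assumes G: "simple_graph G" "S \<subseteq> verts G" and deg: "\<And>v. v \<in> verts G \<Longrightarrow> degree G v \<le> d"
    and "d \<ge> 1"
  shows "card (nbhd G n S) \<le> 2 * d ^ n * card S"
proof (cases n)
  case (Suc m)
  have "card (nbhd G (Suc m) S) \<le> 2 * d ^ Suc m * card S"
  proof (induction m)
    case 0
    let ?N = "\<lambda>v. {u \<in> verts G. {v, u} \<in> edges G}"
    have V: "finite (verts G)" "finite S"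
      using G by (auto simp: simple_graph_def intro: finite_subset)
    have "nbhd G (Suc 0) S \<subseteq> S \<union> (\<Union>u\<in>S. ?N u)" by auto
    then have "card (nbhd G (Suc 0) S) \<le> card (S \<union> (\<Union>u\<in>S. ?N u))"
      using V by (intro card_mono finite_UnI finite_UN_I) auto
    also have "\<dots> \<le> card S + card (\<Union>u\<in>S. ?N u)" by (rule card_Un_le)
    also have "card (\<Union>u\<in>S. ?N u) \<le> d * card S"
      using V deg G(2) by (intro card_UN_bounded) (auto simp: degree_def)
    also have "card S + d * card S \<le> d * card S + d * card S" using \<open>d \<ge> 1\<close> by simp
    finally show ?case by (simp add: algebra_simps)
  next
    case (Suc m)
    have "card (nbhd G (Suc (Suc m)) S) \<le> d * (2 * d ^ Suc m * card S)"
      using card_nbhd_Suc_Suc[OF assms] mult_le_mono2[OF Suc] by (rule order_trans)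
    then show ?case by (simp only: power_Suc mult_ac)
  qed
  with Suc show ?thesis by simp
qed simp

lemma card_incident_edges:
  assumes "simple_graph G"
  shows "card {e \<in> edges G. v \<in> e} \<le> degree G v"
proof -
  let ?N = "{u \<in> verts G. {v, u} \<in> edges G}"
  have fin: "finite ?N" using assms by (simp add: simple_graph_def)
  have "{e \<in> edges G. v \<in> e} \<subseteq> (\<lambda>u. {v, u}) ` ?N"
  proof
    fix e assume e: "e \<in> {e \<in> edges G. v \<in> e}"
    then obtain x y where xy: "e = {x, y}" "x \<in> verts G" "y \<in> verts G"
      using simple_graph_edge[OF assms] by blast
    with e have "v = x \<or> v = y" by auto
    with e xy show "e \<in> (\<lambda>u. {v, u}) ` ?N" by (auto simp: insert_commute)
  qed
  from surj_card_le[OF fin this] show ?thesis by (simp add: degree_def)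
qed

section \<open>Solutions and their distance from \<open>V_H\<close>\<close>

lemma free_of_degree_le:
  assumes "simple_graph G" "\<not> has_clique G (Suc t)" "H \<in> \<H>" "isomorphic H (star s)"
    and "free_of \<H> G" "v \<in> verts G"
  shows "degree G v \<le> ramsey_number s t - 1"
proof (rule ccontr)
  assume "\<not> ?thesis"
  then have "degree G v \<ge> ramsey_number s t" by simp
  from high_degree_in_V_H[OF assms(1-4,6) this] assms(5) show False
    by (auto simp: free_of_def V_H_def)
qed

text \<open>A copy without a deleted edge would survive the deletion.\<close>

lemma solution_edge_in_member:
  assumes "free_of \<H> (delete_edges G E')" "induces_member \<H> G W"
  obtains e where "e \<in> E'" "e \<subseteq> W" "e \<in> edges G"
proof (rule ccontr)
  assume "\<not> thesis"
  with that have "\<And>e. e \<subseteq> W \<Longrightarrow> e \<in> edges G \<longleftrightarrow> e \<in> edges (delete_edges G E')"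
    by (auto simp: delete_edges_def)
  with assms(2) have "induces_member \<H> (delete_edges G E') W"
    by (rule_tac induces_member_cong) (auto simp: delete_edges_def induces_member_def)
  with assms(1) show False by (auto simp: free_of_def)
qed

lemma V_H_near_solution:
  assumes "simple_graph G" "\<And>H. H \<in> \<H> \<Longrightarrow> diameter H \<le> enat D"
    and "free_of \<H> (delete_edges G E')"
  shows "V_H \<H> G \<subseteq> nbhd G D (\<Union>E')"
proof
  fix v assume "v \<in> V_H \<H> G"
  then obtain W where W: "induces_member \<H> G W" "v \<in> W" by (auto simp: V_H_def)
  from solution_edge_in_member[OF assms(3) W(1)]
  obtain e where e: "e \<in> E'" "e \<subseteq> W" "e \<in> edges G" by blast
  from simple_graph_edge[OF assms(1) e(3)] obtain y where y: "y \<in> e" by blast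
  with e have "v \<in> nbhd G D {y}" using induces_member_nbhd[OF W(1) assms(2)] W(2) by blast
  with y e(1) nbhd_mono[of G G "{y}" "\<Union>E'" D D] show "v \<in> nbhd G D (\<Union>E')" by auto
qed

text \<open>Optimality is played against the competitor that keeps the deleted edges up to layer \<open>r\<close> and
  isolates one endpoint, outside layer \<open>r\<close>, of every deleted edge that is new in layer \<open>Suc r\<close>.
  A copy of a member of \<open>\<H>\<close> that survives the competitor is stuck on one side of this barrier.\<close>

lemma solution_layer_bound:
  assumes G: "simple_graph G" and diam: "\<And>H. H \<in> \<H> \<Longrightarrow> diameter H \<le> enat D"
    and E': "E' \<subseteq> edges G" "free_of \<H> (delete_edges G E')"
    and opt: "\<And>F. F \<subseteq> edges G \<Longrightarrow> free_of \<H> (delete_edges G F) \<Longrightarrow> card E' \<le> card F"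
    and deg: "\<And>v. v \<in> verts G - V_H \<H> G \<Longrightarrow> degree G v \<le> d"
  defines "A \<equiv> \<lambda>r. {e \<in> E'. e \<subseteq> nbhd G (r * D) (V_H \<H> G)}"
  shows "card (E' - A r) \<le> d * card (A (Suc r) - A r)"
proof -
  let ?X = "V_H \<H> G"
  let ?C = "\<lambda>r. nbhd G (r * D) ?X"
  have finE: "finite E'" using E'(1) finite_edges[OF G] finite_subset by blast
  define pick where "pick e = (SOME v. v \<in> e - ?C r)" for e
  have pick: "pick e \<in> e" "pick e \<notin> ?C r" if "e \<in> A (Suc r) - A r" for e
  proof -
    from that have "\<exists>v. v \<in> e - ?C r" by (auto simp: A_def)
    from someI_ex[OF this] show "pick e \<in> e" "pick e \<notin> ?C r" by (auto simp: pick_def)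
  qed
  define P where "P = pick ` (A (Suc r) - A r)"
  define I where "I = {e \<in> edges G. e \<inter> P \<noteq> {}}"
  define F where "F = A r \<union> I"
  have finP: "finite P" using finE by (simp add: P_def A_def)
  have P: "p \<in> verts G" "p \<notin> ?C r" if "p \<in> P" for p
  proof -
    from that obtain e where e: "e \<in> A (Suc r) - A r" "p = pick e" by (auto simp: P_def)
    then have "e \<in> edges G" using E'(1) by (auto simp: A_def)
    then have "e \<subseteq> verts G" using G by (simp add: simple_graph_def)
    with pick[OF e(1)] e(2) show "p \<in> verts G" "p \<notin> ?C r" by auto
  qed
  \<comment> \<open>So \<open>P\<close> avoids \<open>V_H \<H> G\<close>, and each vertex of
    \<open>P\<close> costs at most \<open>d\<close> edges to isolate.\<close>
  have X: "?X \<subseteq> ?C r" using nbhd_mono[of G G ?X ?X 0 "r * D"] by simp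
  have "card (\<Union>p\<in>P. {e \<in> edges G. p \<in> e}) \<le> d * card P"
  proof (rule card_UN_bounded[OF finP])
    fix p assume "p \<in> P"
    with P X have "degree G p \<le> d" by (intro deg) auto
    with card_incident_edges[OF G, of p] show "card {e \<in> edges G. p \<in> e} \<le> d" by simp
  qed
  moreover have "I = (\<Union>p\<in>P. {e \<in> edges G. p \<in> e})" by (auto simp: I_def)
  moreover have "card P \<le> card (A (Suc r) - A r)"
    unfolding P_def using finE by (intro card_image_le) (simp add: A_def)
  ultimately have cardI: "card I \<le> d * card (A (Suc r) - A r)"
    by (metis mult_le_mono2 order_trans)
  have "free_of \<H> (delete_edges G F)"
    unfolding free_of_def
  proof (rule notI, elim exE)
    fix W assume W: "induces_member \<H> (delete_edges G F) W"
    \<comment> \<open>Vertices of \<open>P\<close> are isolated after deleting \<open>F\<close>, so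
      a copy through one of them is a single vertex and spans no edge of \<open>G\<close>.\<close>
    have no_edge_P: "W \<inter> P = {}" if e: "e \<in> edges G" "e \<subseteq> W" for e
    proof (rule ccontr)
      assume "W \<inter> P \<noteq> {}"
      then obtain p where p: "p \<in> W" "p \<in> P" by blast
      have "p \<notin> f" if "f \<in> edges (induced (delete_edges G F) W)" for f
        using that p(2) by (auto simp: induced_def delete_edges_def F_def I_def)
      from nbhd_isolated[of _ p, OF this] induces_member_walk[OF W diam p(1)] have "W \<subseteq> {p}" by blast
      with e simple_graph_edge[OF G e(1)] show False by blast
    qed
    have new: "\<not> e \<subseteq> W" if "e \<in> A (Suc r) - A r" for e
      using pick[OF that] no_edge_P[of e] that E'(1) by (auto simp: P_def A_def)
    have F_A: "e \<in> A r" if "e \<in> F" "e \<subseteq> W" for e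
      using that no_edge_P[of e] by (auto simp: F_def I_def)
    \<comment> \<open>If \<open>W\<close> spans an edge of \<open>A r\<close>, it reaches at most
      \<open>D\<close> further out, and the edges of \<open>E'\<close> new in that layer are
      excluded by \<open>new\<close>. Otherwise \<open>W\<close> spans no edge of \<open>F\<close>,
      hence is already a copy in \<open>G\<close> and lies in \<open>V_H \<H> G\<close>.\<close>
    have E'_A: "e \<in> A r" if e: "e \<in> E'" "e \<subseteq> W" for e
    proof (cases "\<exists>f\<in>A r. f \<subseteq> W")
      case True
      then obtain f where f: "f \<in> A r" "f \<subseteq> W" by blast
      with E'(1) have "f \<in> edges G" by (auto simp: A_def)
      from simple_graph_edge[OF G this] obtain x where x: "x \<in> f" by blast
      with f have xC: "{x} \<subseteq> ?C r" by (auto simp: A_def)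
      have "W \<subseteq> nbhd (delete_edges G F) D {x}"
        using induces_member_nbhd[OF W diam] x f(2) by blast
      also have "\<dots> \<subseteq> nbhd G D {x}" by (rule nbhd_mono) (auto simp: delete_edges_def)
      also have "\<dots> \<subseteq> ?C (Suc r)" using nbhd_trans[OF _ xC, of _ D] by auto
      finally have "e \<in> A (Suc r)" using e by (auto simp: A_def)
      with new[of e] e(2) show ?thesis by blast
    next
      case False
      with F_A have "\<not> f \<subseteq> W" if "f \<in> F" for f using that by blast
      then have "induces_member \<H> G W"
        using W by (intro induces_member_cong[OF W])
          (auto simp: delete_edges_def induces_member_def)
      then have "W \<subseteq> ?X" by (auto simp: V_H_def)
      with X e show ?thesis by (auto simp: A_def)
    qed
    \<comment> \<open>Inside \<open>W\<close> both \<open>F\<close> and \<open>E'\<close> amount to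
      \<open>A r\<close>, so \<open>W\<close> would survive \<open>E'\<close> as well.\<close>
    have "e \<in> edges (delete_edges G F) \<longleftrightarrow> e \<in> edges (delete_edges G E')" if "e \<subseteq> W" for e
      using that F_A[of e] E'_A[of e] by (auto simp: delete_edges_def F_def A_def)
    with W have "induces_member \<H> (delete_edges G E') W"
      by (intro induces_member_cong[OF W]) (auto simp: delete_edges_def induces_member_def)
    with E'(2) show False by (auto simp: free_of_def)
  qed
  moreover have "F \<subseteq> edges G" using E'(1) by (auto simp: F_def A_def I_def)
  ultimately have "card E' \<le> card F" by (intro opt)
  also have "\<dots> \<le> card (A r) + card I" unfolding F_def by (rule card_Un_le)
  finally have "card E' \<le> card (A r) + d * card (A (Suc r) - A r)" using cardI by linarith
  moreover have "card E' = card (A r) + card (E' - A r)"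
    using finE card_Un_disjoint[of "A r" "E' - A r"] by (auto simp: A_def Un_absorb1)
  ultimately show ?thesis by linarith
qed

text \<open>By the layer bound each layer captures at least the fraction \<open>1 / d\<close> of the
  edges still outside, so fewer than one edge remains after \<open>r\<close> layers.\<close>

lemma optimal_solution_near_V_H:
  assumes G: "simple_graph G" and diam: "\<And>H. H \<in> \<H> \<Longrightarrow> diameter H \<le> enat D"
    and E': "E' \<subseteq> edges G" "free_of \<H> (delete_edges G E')"
    and opt: "\<And>F. F \<subseteq> edges G \<Longrightarrow> free_of \<H> (delete_edges G F) \<Longrightarrow> card E' \<le> card F"
    and deg: "\<And>v. v \<in> verts G - V_H \<H> G \<Longrightarrow> degree G v \<le> d"
    and "d \<ge> 1" and r: "real (card E') < (2 * real d / (2 * real d - 1)) ^ r"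
  shows "\<Union>E' \<subseteq> nbhd G (r * D) (V_H \<H> G)"
proof -
  define A where "A r = {e \<in> E'. e \<subseteq> nbhd G (r * D) (V_H \<H> G)}" for r
  let ?b = "2 * real d / (2 * real d - 1)"
  have finE: "finite E'" using E'(1) finite_edges[OF G] finite_subset by blast
  have d: "2 * real d - 1 > 0" using \<open>d \<ge> 1\<close> by simp
  have "real (card (E' - A n)) * ?b ^ n \<le> real (card E')" for n
  proof (induction n)
    case 0
    show ?case using finE by (simp add: card_mono)
  next
    case (Suc n)
    let ?a = "real (card (E' - A n))" and ?a' = "real (card (E' - A (Suc n)))"
    let ?c = "real (card (A (Suc n) - A n))"
    have "card (E' - A n) \<le> d * card (A (Suc n) - A n)"
      using solution_layer_bound[OF G diam E' opt deg, of n] by (simp add: A_def)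
    then have "?a \<le> real (d * card (A (Suc n) - A n))" by (rule of_nat_mono)
    then have c: "?a \<le> real d * ?c" by simp
    have "A n \<subseteq> A (Suc n)"
      using nbhd_mono[of G G "V_H \<H> G" "V_H \<H> G" "n * D" "Suc n * D"] by (auto simp: A_def)
    then have "E' - A n = (E' - A (Suc n)) \<union> (A (Suc n) - A n)"
      "(E' - A (Suc n)) \<inter> (A (Suc n) - A n) = {}" by (auto simp: A_def)
    with finE have "card (E' - A n) = card (E' - A (Suc n)) + card (A (Suc n) - A n)"
      by (metis card_Un_disjoint finite_Un finite_Diff)
    then have a': "?a = ?a' + ?c" by simp
    \<comment> \<open>The layer bound allows the ratio \<open>(d - 1) / d\<close>; the weaker
      \<open>(2 * d - 1) / (2 * d)\<close> is the one in the statement, and its inverse is defined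
      also for \<open>d = 1\<close>.\<close>
    have "?a' * (2 * real d) \<le> ?a * (2 * real d - 1)"
      using c a' by (simp add: algebra_simps)
    then have "?a' * ?b \<le> ?a" using d by (simp add: field_simps)
    then have "?a' * ?b * ?b ^ n \<le> ?a * ?b ^ n" using d by (intro mult_right_mono) auto
    with Suc show ?case by (simp add: mult_ac)
  qed
  from this[of r] r have "real (card (E' - A r)) * ?b ^ r < 1 * ?b ^ r" by linarith
  moreover have "?b ^ r > 0" using d \<open>d \<ge> 1\<close> by simp
  ultimately have "card (E' - A r) < 1" by (simp add: mult_less_cancel_right_pos)
  with finE have "E' \<subseteq> A r" by simp
  then show ?thesis by (auto simp: A_def)
qed

section \<open>The trimmed graph\<close>

text \<open>\<open>V_R\<close> is absorbed by \<open>V_H\<close>, and nonnegativity of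
  \<open>T\<close> keeps \<open>nat\<close> from clipping the rounded threshold.\<close>

lemma trim_eq_nbhd:
  fixes G :: "'a graph" and D d k :: nat
  defines "T \<equiv> (2 + log (2 * real d / (2 * real d - 1)) (real k)) * real D"
  assumes "V_R d G \<subseteq> V_H \<H> G" "T \<ge> 0"
  shows "trim \<H> D d G k = induced G (nbhd G (nat \<lfloor>T\<rfloor>) (V_H \<H> G))"
proof -
  let ?X = "V_H \<H> G"
  have X: "?X \<union> V_R d G = ?X" using assms(2) by blast
  have "ereal_of_enat (distance_to_set G v ?X) > ereal T \<longleftrightarrow> v \<notin> nbhd G (nat \<lfloor>T\<rfloor>) ?X" for v
    by (simp only: ereal_of_enat_gt_iff[OF assms(3)] distance_to_set_le_iff[OF V_H_subset_verts])
  then have "verts G - {v \<in> verts G. ereal_of_enat (distance_to_set G v ?X) > ereal T} =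
      nbhd G (nat \<lfloor>T\<rfloor>) ?X"
    using nbhd_subset_verts[OF V_H_subset_verts, of G "nat \<lfloor>T\<rfloor>" \<H>] by blast
  then show ?thesis unfolding trim_def delete_vertices_def X T_def by simp
qed

lemma induces_member_delete_edges_induced:
  assumes "W \<subseteq> B" "B \<subseteq> verts G"
  shows "induces_member \<H> (delete_edges (induced G B) F) W \<longleftrightarrow> induces_member \<H> (delete_edges G F) W"
proof
  assume "induces_member \<H> (delete_edges (induced G B) F) W"
  then show "induces_member \<H> (delete_edges G F) W"
    by (rule induces_member_cong) (use assms in \<open>auto simp: delete_edges_def induced_def\<close>)
next
  assume "induces_member \<H> (delete_edges G F) W"
  then show "induces_member \<H> (delete_edges (induced G B) F) W"
    by (rule induces_member_cong) (use assms in \<open>auto simp: delete_edges_def induced_def\<close>)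
qed

lemma delete_edges_empty: "delete_edges G {} = G"
  by (cases G) (simp add: delete_edges_def)

text \<open>Every copy in \<open>G\<close> lies inside \<open>B\<close>, so restriction neither
  destroys nor creates copies.\<close>

lemma V_H_induced:
  assumes "V_H \<H> G \<subseteq> B" "B \<subseteq> verts G"
  shows "V_H \<H> (induced G B) = V_H \<H> G"
proof -
  have "induces_member \<H> (induced G B) W \<longleftrightarrow> induces_member \<H> G W" for W
  proof (cases "W \<subseteq> B")
    case True
    from induces_member_delete_edges_induced[OF this assms(2), of \<H> "{}"]
    show ?thesis by (simp add: delete_edges_empty)
  next
    case False
    with assms(1) have "\<not> induces_member \<H> G W" by (auto simp: V_H_def)
    moreover from False have "\<not> induces_member \<H> (induced G B) W"
      by (auto simp: induces_member_def induced_def)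
    ultimately show ?thesis by simp
  qed
  then show ?thesis by (simp add: V_H_def)
qed

lemma card_Union_edges_le:
  assumes "\<And>e. e \<in> F \<Longrightarrow> card e = 2" "finite F"
  shows "card (\<Union>F) \<le> 2 * card F"
  using card_UN_bounded[OF assms(2), of "\<lambda>e. e" 2] assms(1) by simp

section \<open>Size of yes-instances and equivalence of the instances\<close>

text \<open>Only after the deletion is the degree at most \<open>d\<close> everywhere, so the ball
  around the endpoints is counted there. The constant 4 is 2 from \<open>card_nbhd_le\<close> times
  2 endpoints per edge.\<close>

lemma card_verts_le_of_solution:
  fixes G :: "'a graph"
  assumes G: "simple_graph G" "\<not> has_clique G (Suc t)"
    and \<H>: "\<And>H. H \<in> \<H> \<Longrightarrow> diameter H \<le> enat D" "H \<in> \<H>" "isomorphic H (star s)"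
    and E': "E' \<subseteq> edges G" "free_of \<H> (delete_edges G E')"
    and near: "verts G \<subseteq> nbhd G n (V_H \<H> G)"
    and d: "ramsey_number s t \<le> d + 1" "d \<ge> 1"
  shows "card (verts G) \<le> 4 * d ^ (n + D) * card E'"
proof -
  let ?G = "delete_edges G E'"
  have GE: "simple_graph ?G" by (rule simple_graph_delete_edges[OF G(1)])
  have "\<not> has_clique ?G (Suc t)"
    using G(2) has_clique_mono[of ?G "Suc t" G] by (auto simp: delete_edges_def)
  from free_of_degree_le[OF GE this \<H>(2,3) E'(2)] d(1)
  have deg: "\<And>v. v \<in> verts ?G \<Longrightarrow> degree ?G v \<le> d" by fastforce
  have S: "\<Union>E' \<subseteq> verts ?G"
    using E'(1) G(1) by (auto simp: simple_graph_def delete_edges_def)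
  have "verts G \<subseteq> nbhd G (n + D) (\<Union>E')"
    using near nbhd_trans[OF _ V_H_near_solution[OF G(1) \<H>(1) E'(2)]] by blast
  also have "\<dots> \<subseteq> nbhd ?G (n + D) (\<Union>E')" by (rule nbhd_delete_edges)
  finally have "card (verts G) \<le> card (nbhd ?G (n + D) (\<Union>E'))"
    using nbhd_subset_verts[OF S, of "n + D"] GE
    by (intro card_mono) (auto simp: simple_graph_def intro: finite_subset)
  also have "\<dots> \<le> 2 * d ^ (n + D) * card (\<Union>E')"
    by (rule card_nbhd_le[OF GE S deg d(2)])
  also have "\<dots> \<le> 2 * d ^ (n + D) * (2 * card E')"
    using E'(1) G(1) finite_edges[OF G(1)]
    by (intro mult_left_mono card_Union_edges_le) (auto simp: simple_graph_def intro: finite_subset)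
  finally show ?thesis by simp
qed

text \<open>Budget 0 deletes nothing, and \<open>K\<close> is itself a copy of a member.\<close>

lemma star_not_yes:
  fixes K :: "'a graph"
  assumes "simple_graph K" "isomorphic K (star s)" "H \<in> \<H>" "isomorphic H (star s)"
  shows "\<not> edge_deletion_yes \<H> (K, 0)"
proof
  assume "edge_deletion_yes \<H> (K, 0)"
  then obtain E' where E': "E' \<subseteq> edges K" "card E' = 0" "free_of \<H> (delete_edges K E')"
    by (auto simp: edge_deletion_yes_def)
  with finite_edges[OF assms(1)] have "E' = {}" using finite_subset by fastforce
  with E'(3) have "free_of \<H> K" by (simp add: delete_edges_empty)
  moreover have "induced K (verts K) = K"
    using assms(1) by (cases K) (auto simp: induced_def simple_graph_def)
  with isomorphic_trans[OF assms(2) isomorphic_sym[OF assms(4)]] assms(3)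
  have "induces_member \<H> K (verts K)" by (auto simp: induces_member_def)
  ultimately show False by (auto simp: free_of_def)
qed

text \<open>Being \<open>\<H>\<close>-free passes to induced subgraphs, so a solution can be
  restricted to the edges inside \<open>B\<close>.\<close>

lemma edge_deletion_yes_induced:
  assumes G: "simple_graph G" "B \<subseteq> verts G" and "edge_deletion_yes \<H> (G, k)"
  shows "edge_deletion_yes \<H> (induced G B, k)"
proof -
  from assms(3) obtain E' where E': "E' \<subseteq> edges G" "card E' \<le> k" "free_of \<H> (delete_edges G E')"
    by (auto simp: edge_deletion_yes_def)
  let ?F = "E' \<inter> edges (induced G B)"
  have "finite E'" using finite_edges[OF G(1)] E'(1) finite_subset by blast
  then have "card ?F \<le> k" using E'(2) card_mono[of E' ?F] by auto
  moreover have "delete_edges (induced G B) ?F = delete_edges (induced G B) E'"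
    by (auto simp: delete_edges_def)
  moreover have "free_of \<H> (delete_edges (induced G B) E')"
    unfolding free_of_def
  proof
    assume "\<exists>W. induces_member \<H> (delete_edges (induced G B) E') W"
    then obtain W where W: "induces_member \<H> (delete_edges (induced G B) E') W" by blast
    then have "W \<subseteq> B" by (auto simp: induces_member_def induced_def delete_edges_def)
    with W E'(3) G(2) show False by (auto simp: induces_member_delete_edges_induced free_of_def)
  qed
  ultimately show ?thesis unfolding edge_deletion_yes_def by (auto intro!: exI[of _ ?F])
qed

lemma edge_deletion_yes_of_nbhd:
  fixes G :: "'a graph"
  assumes G: "simple_graph G" and diam: "\<And>H. H \<in> \<H> \<Longrightarrow> diameter H \<le> enat D"
    and deg: "\<And>v. v \<in> verts G - V_H \<H> G \<Longrightarrow> degree G v \<le> d"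
    and "d \<ge> 1" and r: "real k < (2 * real d / (2 * real d - 1)) ^ r" "r * D + D \<le> n"
    and yes: "edge_deletion_yes \<H> (induced G (nbhd G n (V_H \<H> G)), k)"
  shows "edge_deletion_yes \<H> (G, k)"
proof -
  let ?X = "V_H \<H> G"
  define B where "B = nbhd G n ?X"
  let ?G = "induced G B"
  have B: "?X \<subseteq> B" "B \<subseteq> verts G"
    using nbhd_mono[of G G ?X ?X 0 n] nbhd_subset_verts[OF V_H_subset_verts, of G n \<H>]
    by (simp_all add: B_def)
  have G': "simple_graph ?G" by (rule simple_graph_induced[OF G B(2)])
  have X': "V_H \<H> ?G = ?X" by (rule V_H_induced[OF B])
  let ?sol = "\<lambda>F. F \<subseteq> edges ?G \<and> free_of \<H> (delete_edges ?G F)"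
  from yes obtain E0 where E0: "?sol E0" "card E0 \<le> k"
    by (auto simp: edge_deletion_yes_def B_def)
  \<comment> \<open>A minimum solution of the trimmed graph is chosen because the layer bound
    requires optimality; it then solves \<open>G\<close> itself.\<close>
  from ex_has_least_nat[of ?sol E0 card, OF E0(1)]
  obtain E' where E': "?sol E'" and opt: "\<And>F. ?sol F \<Longrightarrow> card E' \<le> card F" by blast
  have "card E' \<le> k" using opt[OF E0(1)] E0(2) by simp
  then have r': "real (card E') < (2 * real d / (2 * real d - 1)) ^ r" using r(1) by linarith
  have deg': "degree ?G v \<le> d" if "v \<in> verts ?G - V_H \<H> ?G" for v
  proof -
    have "degree ?G v \<le> degree G v"
      unfolding degree_def using G B(2)
      by (intro card_mono) (auto simp: simple_graph_def induced_def)
    also have "\<dots> \<le> d" using that B(2) X' by (intro deg) (auto simp: induced_def)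
    finally show ?thesis .
  qed
  have "\<Union>E' \<subseteq> nbhd ?G (r * D) (V_H \<H> ?G)"
    using E' opt by (intro optimal_solution_near_V_H[OF G' diam _ _ _ deg' \<open>d \<ge> 1\<close> r']) auto
  also have "\<dots> \<subseteq> nbhd G (r * D) ?X"
    unfolding X' using B(2) by (intro nbhd_mono) (auto simp: induced_def)
  finally have near: "\<Union>E' \<subseteq> nbhd G (r * D) ?X" .
  have "free_of \<H> (delete_edges G E')"
    unfolding free_of_def
  proof
    assume "\<exists>W. induces_member \<H> (delete_edges G E') W"
    then obtain W where W: "induces_member \<H> (delete_edges G E') W" by blast
    \<comment> \<open>A copy spanning a deleted edge lies within \<open>r * D + D \<le> n\<close> of
      \<open>V_H \<H> G\<close>; any other copy is one of \<open>G\<close> and lies in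
      \<open>V_H \<H> G\<close>.\<close>
    have "W \<subseteq> B"
    proof (cases "\<exists>e\<in>E'. e \<subseteq> W")
      case True
      then obtain e where e: "e \<in> E'" "e \<subseteq> W" by blast
      with E' have "e \<in> edges G" by (auto simp: induced_def)
      from simple_graph_edge[OF G this] obtain x where x: "x \<in> e" by blast
      with e near have xX: "{x} \<subseteq> nbhd G (r * D) ?X" by blast
      have "W \<subseteq> nbhd (delete_edges G E') D {x}"
        using induces_member_nbhd[OF W diam] x e(2) by blast
      also have "\<dots> \<subseteq> nbhd G D {x}" by (rule nbhd_mono) (auto simp: delete_edges_def)
      also have "\<dots> \<subseteq> nbhd G (D + r * D) ?X" using nbhd_trans[OF _ xX, of _ D] by auto
      also have "\<dots> \<subseteq> B" unfolding B_def using r(2) by (intro nbhd_mono) auto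
      finally show ?thesis .
    next
      case False
      then have "induces_member \<H> G W"
        using W by (intro induces_member_cong[OF W])
          (auto simp: delete_edges_def induces_member_def)
      then have "W \<subseteq> ?X" by (auto simp: V_H_def)
      with B(1) show ?thesis by blast
    qed
    from W E' induces_member_delete_edges_induced[OF this B(2), of \<H> E'] show False
      by (auto simp: free_of_def)
  qed
  moreover have "E' \<subseteq> edges G" using E' by (auto simp: induced_def)
  ultimately show ?thesis using \<open>card E' \<le> k\<close> by (auto simp: edge_deletion_yes_def)
qed

section \<open>Choice of the radii and the final estimates\<close>

theorem theorem2:
  fixes \<H> :: "'b graph set" and G K :: "'a graph" and D s t d k :: nat and p :: real
  assumes "finite \<H>"
    and "\<And>H. H \<in> \<H> \<Longrightarrow> simple_graph H \<and> connected_graph H"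
    and "enat D = Max (diameter ` \<H>)"
    and "s > 1" and "\<exists>H\<in>\<H>. isomorphic H (star s)"
    and "\<And>s'. s' > 1 \<Longrightarrow> \<exists>H\<in>\<H>. isomorphic H (star s') \<Longrightarrow> s \<le> s'"
    and "t > 2"
    and "d = ramsey_number s (t - 1) - 1"
    and "p = log (2 * real d / (2 * real d - 1)) (real d)"
    and "simple_graph K" and "isomorphic K (star s)"
    and "simple_graph G" and "free_of {complete_graph t} G" and "k > 0"
  shows "real (card (verts (fst (kernelize \<H> K D d p (G, k)))))
             \<le> 8 * real d ^ (1 + 3 * D) * real k powr (1 + p * real D)
         \<and> (edge_deletion_yes \<H> (kernelize \<H> K D d p (G, k)) \<longleftrightarrow> edge_deletion_yes \<H> (G, k))"
proof -
  note G = \<open>simple_graph G\<close>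
  let ?X = "V_H \<H> G" and ?b = "2 * real d / (2 * real d - 1)"
  from assms(5) obtain H where H: "H \<in> \<H>" "isomorphic H (star s)" by blast
  have diam: "diameter H' \<le> enat D" if "H' \<in> \<H>" for H'
    using that assms(1,3) by simp
  have "ramsey_number s (t - 1) \<ge> s" using assms(7) by (intro ramsey_number_ge) simp
  \<comment> \<open>Since \<open>s > 1\<close>, the Ramsey number is positive and the subtraction
    defining \<open>d\<close> loses nothing.\<close>
  then have sd: "s \<le> d + 1" "d \<ge> 1" and ram: "ramsey_number s (t - 1) = d + 1"
    using assms(4,8) by linarith+
  have t: "Suc (t - 1) = t" using assms(7) by simp
  have cl: "\<not> has_clique G (Suc (t - 1))" unfolding t by (rule clique_free_of[OF G assms(13)])
  have deg: "v \<in> ?X" if "v \<in> verts G" "degree G v \<ge> d + 1" for v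
    using high_degree_in_V_H[OF G cl H that(1)] that(2) ram by simp
  define L where "L = log ?b (real k)"
  have b: "?b > 1" using sd(2) by simp
  have L: "L \<ge> 0" unfolding L_def using b assms(14) by simp
  define n where "n = nat \<lfloor>(2 + L) * real D\<rfloor>"
  define B where "B = nbhd G n ?X"
  have trim: "trim \<H> D d G k = induced G B"
    unfolding B_def n_def L_def
    by (rule trim_eq_nbhd) (use deg L in \<open>auto simp: V_R_def L_def[symmetric]\<close>)
  \<comment> \<open>The least natural number above \<open>L\<close>: then \<open>?b ^ r\<close>
    exceeds \<open>k\<close>, while \<open>r \<le> L + 1\<close> leaves one \<open>D\<close> of the
    radius \<open>(2 + L) * D\<close> for a copy meeting the solution.\<close>
  define r where "r = nat \<lfloor>L\<rfloor> + 1"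
  have rL: "L < real r" "real r \<le> L + 1" using L by (auto simp: r_def) linarith+
  have "real k = ?b powr L" unfolding L_def using b assms(14) by simp
  also have "\<dots> < ?b powr real r" using b rL(1) by simp
  also have "\<dots> = ?b ^ r" using b by (intro powr_realpow) simp
  finally have rk: "real k < ?b ^ r" .
  have "real (r * D + D) \<le> (2 + L) * real D"
    using mult_right_mono[OF rL(2), of "real D"] by (simp add: algebra_simps)
  then have rn: "r * D + D \<le> n" unfolding n_def by linarith
  have BV: "B \<subseteq> verts G" unfolding B_def by (rule nbhd_subset_verts[OF V_H_subset_verts])
  have equiv: "edge_deletion_yes \<H> (induced G B, k) \<longleftrightarrow> edge_deletion_yes \<H> (G, k)"
  proof
    assume "edge_deletion_yes \<H> (induced G B, k)"
    then show "edge_deletion_yes \<H> (G, k)" unfolding B_def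
      by (rule edge_deletion_yes_of_nbhd[OF G diam _ sd(2) rk rn, rotated 2])
        (use deg in \<open>auto simp: not_less_eq_eq[symmetric]\<close>)
  qed (rule edge_deletion_yes_induced[OF G BV])
  have p: "p \<ge> 0" unfolding assms(9) using b sd(2) by simp
  \<comment> \<open>Both sides equal \<open>?b powr (p * L)\<close>. This turns the logarithm of
    \<open>k\<close> in the exponent into a power of \<open>k\<close>.\<close>
  have dL: "real d powr L = real k powr p"
  proof -
    have "real d = ?b powr p" "real k = ?b powr L"
      unfolding assms(9) L_def using b sd(2) assms(14) by simp_all
    then show ?thesis by (metis powr_powr mult.commute)
  qed
  let ?bound = "8 * real d ^ (3 * D + 1) * real k powr (p * real D + 1)"
  have size: "real (card (verts (induced G B))) \<le> ?bound" if "edge_deletion_yes \<H> (G, k)"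
  proof -
    let ?G = "induced G B"
    from that equiv obtain E' where E': "E' \<subseteq> edges ?G" "card E' \<le> k" "free_of \<H> (delete_edges ?G E')"
      by (auto simp: edge_deletion_yes_def)
    have "\<not> has_clique ?G (Suc (t - 1))"
      using cl has_clique_mono[of ?G _ G] BV by (auto simp: induced_def)
    moreover have "?X \<subseteq> B" unfolding B_def using nbhd_mono[of G G ?X ?X 0 n] by simp
    then have "V_H \<H> ?G = ?X" by (rule V_H_induced[OF _ BV])
    then have "verts ?G \<subseteq> nbhd ?G n (V_H \<H> ?G)"
      using nbhd_induced[of n n G ?X] by (simp add: B_def induced_def)
    ultimately have "card (verts ?G) \<le> 4 * d ^ (n + D) * card E'"
      using card_verts_le_of_solution[OF simple_graph_induced[OF G BV] _ diam H E'(1,3)] ram sd(2)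
      by auto
    also have "\<dots> \<le> 4 * d ^ (n + D) * k" using E'(2) by simp
    finally have "real (card (verts ?G)) \<le> real (4 * d ^ (n + D) * k)" by (rule of_nat_mono)
    then have card: "real (card (verts ?G)) \<le> 4 * real d ^ (n + D) * real k" by simp
    have "real d ^ (n + D) = real d powr real (n + D)"
      using sd(2) by (intro powr_realpow[symmetric]) simp
    \<comment> \<open>The 3 is 2 from the trimming radius and 1 from the distance between
      \<open>V_H\<close> and the solution.\<close>
    also have "\<dots> \<le> real d powr (real (3 * D) + L * real D)"
    proof (rule powr_mono)
      have "real n \<le> (2 + L) * real D" unfolding n_def using L by simp
      then show "real (n + D) \<le> real (3 * D) + L * real D" by (simp add: algebra_simps)
    qed (use sd(2) in simp)
    also have "\<dots> = real d powr real (3 * D) * (real d powr L) powr real D"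
      by (simp only: powr_add powr_powr)
    also have "\<dots> = real d ^ (3 * D) * real k powr (p * real D)"
      using sd(2) powr_realpow[of "real d" "3 * D"] by (simp only: dL powr_powr)
    finally have "real d ^ (n + D) \<le> real d ^ (3 * D) * real k powr (p * real D)" .
    from mult_right_mono[OF this, of "real k"] have "4 * real d ^ (n + D) * real k
        \<le> 4 * 1 * ((real d ^ (3 * D) * real k powr (p * real D)) * real k)"
      by simp
    \<comment> \<open>The slack \<open>4 \<le> 8 * d\<close> gives the form of the stated
      bound.\<close>
    also have "\<dots> \<le> 8 * real d * ((real d ^ (3 * D) * real k powr (p * real D)) * real k)"
      using sd(2) by (intro mult_right_mono) auto
    also have "\<dots> = ?bound" using assms(14) by (simp add: powr_add)
    finally show ?thesis by (rule order_trans[OF card])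
  qed
  have sizeK: "real (card (verts K)) \<le> ?bound"
  proof -
    have "card (verts K) = s + 1"
      using assms(11) bij_betw_same_card by (fastforce simp: isomorphic_def star_def)
    \<comment> \<open>\<open>s + 1 \<le> d + 2 \<le> 8 * d\<close>; the other factors of the bound
      are at least 1.\<close>
    then have "real (card (verts K)) \<le> 8 * real d * 1 * 1" using sd by simp
    also have "\<dots> \<le> 8 * real d * real d ^ (3 * D) * real k powr (p * real D + 1)"
      using sd(2) assms(14) p by (intro mult_mono one_le_power ge_one_powr_ge_zero) auto
    finally show ?thesis by (simp add: mult_ac)
  qed
  show ?thesis
  proof (cases "real (card (verts (induced G B))) > ?bound")
    case True
    then have "kernelize \<H> K D d p (G, k) = (K, 0)" by (simp add: kernelize_def trim Let_def)
    \<comment> \<open>By the contrapositive of \<open>size\<close>, both \<open>(G, k)\<close> and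
      the output \<open>(K, 0)\<close> are no-instances.\<close>
    moreover from True size have "\<not> edge_deletion_yes \<H> (G, k)" by linarith
    ultimately show ?thesis
      using sizeK star_not_yes[OF assms(10,11) H] by (simp add: add.commute mult_ac)
  next
    case False
    then have "kernelize \<H> K D d p (G, k) = (induced G B, k)"
      by (simp add: kernelize_def trim Let_def)
    with False equiv show ?thesis by (simp add: add.commute mult_ac)
  qed
qed

end
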